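(* Let $N\ge 1$, $0<R\leq\infty$, and let $V\geq 0$ and $W$ be $C^{1}$-functions on $(0,R)$. Assume that $(r^{N-1}V,r^{N-1}W)$ is a Bessel pair on $(0,R)$ with corresponding solution $\varphi>0$. Then for every $u\in C_{0}^{\infty}(B_{R}\setminus\{0\})$ for which the integrals $\int_{B_R}V(\rho)|\nabla_{\mathbb H}u|^2dV_{\mathbb H}$ and $\int_{B_R}V(\rho)\frac{(\varphi'(\rho))^2}{\varphi^2(\rho)}|u|^2dV_{\mathbb H}$ are both positive, setting $$\lambda=\left(\frac{\int_{B_{R}}V(\rho(x))\frac{(\varphi'(\rho(x)))^{2}}{\varphi^{2}(\rho(x))}|u|^{2}dV_{\mathbb{H}}}{\int_{B_{R}}V(\rho(x))|\nabla_{\mathbb{H}}u|^{2}dV_{\mathbb{H}}}\right)^{1/4},$$ we have $$\begin{aligned}&\left(\int_{B_{R}}V(\rho(x))|\nabla_{\mathbb{H}}u|^{2}dV_{\mathbb{H}}\right)^{1/2}\left(\int_{B_{R}}V(\rho(x))\frac{(\varphi'(\rho(x)))^{2}}{\varphi^{2}(\rho(x))}|u|^{2}dV_{\mathbb{H}}\right)^{1/2}\\&=\frac12\int_{B_{R}}\left(W(\rho(x))+V(\rho(x))\frac{(\varphi'(\rho(x)))^{2}}{\varphi^{2}(\rho(x))}\right)|u|^{2}dV_{\mathbb{H}}\\&\quad-\frac{N-1}{2}\int_{B_{R}}V(\rho(x))\frac{\varphi'(\rho(x))}{\varphi(\rho(x))}\left(\frac{\rho(x)\cosh\rho(x)-\sinh\rho(x)}{\rho(x)\sinh\rho(x)}\right)|u|^{2}dV_{\mathbb{H}}\\&\quad+\frac12\int_{B_{R}}V(\rho(x))\left|\frac1\lambda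 u\frac{\varphi'(\rho(x))}{\varphi(\rho(x))}\nabla_{\mathbb{H}}\rho(x)-\lambda\nabla_{\mathbb{H}}u\right|^{2}dV_{\mathbb{H}}.\end{aligned}$$ In particular, if $\frac{\varphi'}{\varphi}$ is nonpositive, then for all $u\in C_{0}^{\infty}(B_{R}\setminus\{0\})$, $$\left(\int_{B_{R}}V(\rho(x))|\nabla_{\mathbb{H}}u|^{2}dV_{\mathbb{H}}\right)^{1/2}\left(\int_{B_{R}}V(\rho(x))\frac{(\varphi'(\rho(x)))^{2}}{\varphi^{2}(\rho(x))}|u|^{2}dV_{\mathbb{H}}\right)^{1/2}\geq\frac12\int_{B_{R}}\left(W(\rho(x))+V(\rho(x))\frac{(\varphi'(\rho(x)))^{2}}{\varphi^{2}(\rho(x))}\right)|u|^{2}dV_{\mathbb{H}}.$$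
   Context: $\mathbb{H}^{N}$ is the hyperbolic space in the Poincaré ball model: the Euclidean unit ball with Riemannian metric $\left(\frac{2}{1-|x|^{2}}\right)^{2}dx^{2}$, volume element $dV_{\mathbb{H}}=\left(\frac{2}{1-|x|^{2}}\right)^{N}dx$, Riemannian gradient $\nabla_{\mathbb{H}}=\left(\frac{1-|x|^{2}}{2}\right)^{2}\nabla$; $|\nabla_{\mathbb H}u|$ and other norms of tangent vectors are Riemannian norms. $\rho(x)=\log\frac{1+|x|}{1-|x|}$ is the hyperbolic distance from $x$ to $0$, and $B_R=\{x\in\mathbb{H}^N:\rho(x)<R\}$ ($B_\infty=\mathbb{H}^N$). Functions are real-valued; $C_0^\infty$ means smooth with compact support. The pair $(r^{N-1}V,r^{N-1}W)$ is a Bessel pair on $(0,R)$ with corresponding solution $\varphi$ if $\varphi>0$ on $(0,R)$ is a (classical, twice differentiable) solution of $(r^{N-1}V\varphi')'+r^{N-1}W\varphi=0$ on $(0,R)$. *)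

theory Defs
  imports "HOL-Analysis.Analysis"
begin

text \<open>
  The Poincare ball model of hyperbolic \<open>N\<close>-space: points are elements of the Euclidean unit
  ball of \<^typ>\<open>real ^ 'n\<close> with \<open>N = CARD('n)\<close>, and tangent vectors are elements of the same type.
\<close>

text \<open>The metric tensor \<open>(2 / (1 - |x|\<^sup>2))\<^sup>2 dx\<^sup>2\<close> and the induced norm on tangent vectors at \<open>x\<close>.\<close>

definition hyp_inner :: "real ^ 'n \<Rightarrow> real ^ 'n \<Rightarrow> real ^ 'n \<Rightarrow> real" where
  "hyp_inner x v w = (2 / (1 - (norm x)\<^sup>2))\<^sup>2 * (v \<bullet> w)"

definition hyp_norm :: "real ^ 'n \<Rightarrow> real ^ 'n \<Rightarrow> real" where
  "hyp_norm x v = sqrt (hyp_inner x v v)"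

definition hyp_volume :: "(real ^ 'n) measure" where
  "hyp_volume = density lborel
     (\<lambda>x. indicator (ball 0 1) x * ennreal ((2 / (1 - (norm x)\<^sup>2)) ^ CARD('n)))"

definition euclidean_grad :: "(real ^ 'n \<Rightarrow> real) \<Rightarrow> real ^ 'n \<Rightarrow> real ^ 'n" where
  "euclidean_grad f x = (\<chi> i. frechet_derivative f (at x) (axis i 1))"

definition hyp_grad :: "(real ^ 'n \<Rightarrow> real) \<Rightarrow> real ^ 'n \<Rightarrow> real ^ 'n" where
  "hyp_grad f x = ((1 - (norm x)\<^sup>2) / 2)\<^sup>2 *\<^sub>R euclidean_grad f x"

text \<open>The hyperbolic distance to the origin; only meaningful for \<open>norm x < 1\<close>.\<close>

definition hyp_rho :: "real ^ 'n \<Rightarrow> real" where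
  "hyp_rho x = ln ((1 + norm x) / (1 - norm x))"

definition hyp_ball :: "ereal \<Rightarrow> (real ^ 'n) set" where
  "hyp_ball R = {x. norm x < 1 \<and> ereal (hyp_rho x) < R}"

text \<open>The interval \<open>(0, R)\<close>, where \<open>R = \<infinity>\<close> is allowed.\<close>

definition radial_interval :: "ereal \<Rightarrow> real set" where
  "radial_interval R = {r. 0 < r \<and> ereal r < R}"

text \<open>Functions of class \<open>C\<^sup>k\<close> and \<open>C\<^sup>\<infinity>\<close>; to be used on open sets \<open>S\<close> only.\<close>

primrec Ck_on :: "nat \<Rightarrow> 'a::euclidean_space set \<Rightarrow> ('a \<Rightarrow> real) \<Rightarrow> bool" where
  "Ck_on 0 S f \<longleftrightarrow> continuous_on S f"
| "Ck_on (Suc k) S f \<longleftrightarrow>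
     (\<forall>x\<in>S. f differentiable (at x)) \<and> (\<forall>v. Ck_on k S (\<lambda>x. frechet_derivative f (at x) v))"

definition smooth_on :: "'a::euclidean_space set \<Rightarrow> ('a \<Rightarrow> real) \<Rightarrow> bool" where
  "smooth_on S f \<longleftrightarrow> (\<forall>k. Ck_on k S f)"

text \<open>
  \<open>C\<^sub>0\<^sup>\<infinity>(S)\<close> for open \<open>S\<close>: smooth functions whose support is a compact subset of \<open>S\<close>.  Since
  functions are total, elements of this space are understood to be extended by \<open>0\<close> outside \<open>S\<close>.
\<close>

definition test_functions :: "'a::euclidean_space set \<Rightarrow> ('a \<Rightarrow> real) set" where
  "test_functions S =
     {u. smooth_on S u \<and> compact (closure {x. u x \<noteq> 0}) \<and> closure {x. u x \<noteq> 0} \<subseteq> S}"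

text \<open>
  \<open>(P, Q)\<close> is a Bessel pair on \<open>(0, R)\<close> with corresponding solution \<open>\<phi>\<close>: \<open>\<phi>\<close> is a positive,
  twice differentiable solution of \<open>(P \<phi>')' + Q \<phi> = 0\<close> on \<open>(0, R)\<close>.
\<close>

definition bessel_pair ::
    "ereal \<Rightarrow> (real \<Rightarrow> real) \<Rightarrow> (real \<Rightarrow> real) \<Rightarrow> (real \<Rightarrow> real) \<Rightarrow> bool" where
  "bessel_pair R P Q \<phi> \<longleftrightarrow>
     (\<forall>r\<in>radial_interval R.
        \<phi> r > 0 \<and> \<phi> differentiable (at r) \<and> deriv \<phi> differentiable (at r) \<and>
        (\<lambda>s. P s * deriv \<phi> s) differentiable (at r) \<and>
        deriv (\<lambda>s. P s * deriv \<phi> s) r + Q r * \<phi> r = 0)"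

end

theory Submission imports Defs
begin

text \<open>
  Expanding the square reduces the identity to
  \<open>2 \<integral> V (\<phi>'/\<phi>) u \<langle>\<nabla>\<rho>, \<nabla>u\<rangle> = \<integral> (W + V (\<phi>'/\<phi>)\<^sup>2) u\<^sup>2 - (N - 1) \<integral> V (\<phi>'/\<phi>) (coth \<rho> - 1/\<rho>) u\<^sup>2\<close>.
  This is integration by parts against the radial field \<open>V(\<rho>) (\<phi>'/\<phi>)(\<rho>) \<nabla>\<rho>\<close>: its divergence is
  \<open>(V \<phi>'/\<phi>)' + (N - 1) (coth \<rho>) V \<phi>'/\<phi>\<close>, and the Bessel equation turns the first summand into
  \<open>- W - (N - 1) V \<phi>' / (\<rho> \<phi>) - V (\<phi>'/\<phi>)\<^sup>2\<close>.  If \<open>\<phi>'/\<phi> \<le> 0\<close>, the last integral is nonpositive since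
  \<open>coth \<rho> \<ge> 1/\<rho>\<close>, and the Cauchy-Schwarz inequality bounds the left-hand side, so that the inequality
  also holds for \<open>u\<close> with vanishing integrals.
\<close>

section \<open>Compactly supported functions and integration by parts in Euclidean space\<close>

text \<open>The open sets \<open>S\<close> and \<open>- K\<close> cover the space; \<open>h\<close>
  is continuous on the first and zero on the second. Continuity has to be checked only on
  \<open>S\<close>, where the formulas below are regular, and integrability follows.\<close>

lemma
  fixes h :: "'a::euclidean_space \<Rightarrow> real"
  assumes "open S" "compact K" "K \<subseteq> S" "continuous_on S h" "\<And>x. x \<notin> K \<Longrightarrow> h x = 0"
  shows continuous_on_compact_support: "continuous_on UNIV h"
    and integrable_compact_support: "integrable lborel h"
proof -
  have "continuous_on (- K) h"
    using assms(5) by (subst continuous_on_cong[where g = "\<lambda>_. 0"]) auto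
  moreover have "S \<union> - K = UNIV" using assms by auto
  moreover have "open (- K)" using assms by (simp add: compact_imp_closed open_Compl)
  ultimately show *: "continuous_on UNIV h"
    using continuous_on_open_Un[of S "- K" h] assms by auto
  have "integrable lborel (\<lambda>x. indicator K x *\<^sub>R h x)"
    by (rule borel_integrable_compact) (use * assms continuous_on_subset in blast)+
  moreover have "(\<lambda>x. indicator K x *\<^sub>R h x) = h"
    using assms(5) by (auto simp: indicator_def fun_eq_iff)
  ultimately show "integrable lborel h" by simp
qed

lemma has_derivative_zero_outside:
  assumes "closed K" "\<And>x. x \<notin> K \<Longrightarrow> f x = 0" "x \<notin> K"
  shows "(f has_derivative (\<lambda>_. 0)) (at x)"
proof (rule has_derivative_transform_within_open)
  show "((\<lambda>_. 0) has_derivative (\<lambda>_. 0)) (at x)" by simp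
  show "open (- K)" using assms(1) by auto
qed (use assms in auto)

lemma integral_lborel_translate:
  fixes f :: "'a::euclidean_space \<Rightarrow> real"
  assumes "f \<in> borel_measurable borel"
  shows "(LINT x|lborel. f (x + c)) = (LINT x|lborel. f x)"
proof -
  have "(LINT x|lborel. f x) = (LINT x|distr lborel borel ((+) c). f x)"
    by (simp add: lborel_distr_plus)
  also have "\<dots> = (LINT x|lborel. f (c + x))"
    using assms by (subst integral_distr) auto
  finally show ?thesis by (simp add: add.commute)
qed

text \<open>The integrals of the difference quotients vanish by translation invariance of the measure.\<close>

lemma integral_directional_derivative_eq_0:
  fixes f :: "'a::euclidean_space \<Rightarrow> real"
  assumes deriv: "\<And>x. (f has_derivative f' x) (at x)"
    and cont: "continuous_on UNIV (\<lambda>x. f' x v)"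
    and K: "compact K" "\<And>x. x \<notin> K \<Longrightarrow> f x = 0"
  shows "(LINT x|lborel. f' x v) = 0"
proof -
  have fcont: "continuous_on UNIV f"
    using has_derivative_continuous[OF deriv] by (simp add: continuous_at_imp_continuous_on)
  have f'0: "f' x v = 0" if "x \<notin> K" for x
  proof -
    have "f' x = (\<lambda>_. 0)"
      using compact_imp_closed[OF K(1)] K(2) that
      by (rule has_derivative_unique[OF deriv has_derivative_zero_outside])
    then show ?thesis by simp
  qed
  obtain M where M: "\<And>x. \<bar>f' x v\<bar> \<le> M"
  proof -
    have "compact ((\<lambda>x. f' x v) ` K)"
      by (rule compact_continuous_image[OF continuous_on_subset[OF cont] K(1)]) simp
    then obtain M where "\<forall>x\<in>K. \<bar>f' x v\<bar> \<le> M"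
      by (auto dest!: compact_imp_bounded simp: bounded_iff)
    \<comment> \<open>Off \<open>K\<close> the derivative is zero, while the bound found on
      \<open>K\<close> may be negative if \<open>K\<close> is empty.\<close>
    then have "\<bar>f' x v\<bar> \<le> max M 0" for x
      using f'0[of x] by (cases "x \<in> K") (auto simp: le_max_iff_disj)
    then show ?thesis by (rule that)
  qed
  obtain r where r: "\<forall>x\<in>K. norm x \<le> r"
    using compact_imp_bounded[OF K(1)] by (auto simp: bounded_iff)
  \<comment> \<open>All steps satisfy \<open>s k \<le> 1\<close>, so enlarging the radius by
    \<open>norm v\<close> makes every quotient \<open>q k\<close> vanish outside \<open>L\<close>.
    This gives the single dominating function \<open>M * indicator L x\<close>.\<close>
  define L where "L = cball (0::'a) (r + norm v)"
  define s where "s k = 1 / real (Suc k)" for k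
  have s: "0 < s k" "s k \<le> 1" for k by (auto simp: s_def)
  define q where "q k x = (f (x + s k *\<^sub>R v) - f x) / s k" for k x
  have line: "((\<lambda>t. f (x + t *\<^sub>R v)) has_real_derivative f' (x + t *\<^sub>R v) v) (at t)" for x t
  proof -
    interpret D: bounded_linear "f' (x + t *\<^sub>R v)"
      using deriv has_derivative_bounded_linear by blast
    have "((\<lambda>t. f (x + t *\<^sub>R v)) has_derivative (\<lambda>h. f' (x + t *\<^sub>R v) (h *\<^sub>R v))) (at t)"
      by (rule has_derivative_compose[OF _ deriv]) (auto intro!: derivative_eq_intros)
    then show ?thesis
      by (auto simp: has_field_derivative_def D.scaleR mult.commute elim!: has_derivative_eq_rhs)
  qed
  have bound: "\<bar>q k x\<bar> \<le> M * indicator L x" for k x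
  proof (cases "x \<in> L")
    case True
    \<comment> \<open>The mean value theorem on the segment from \<open>x\<close> to
      \<open>x + s k *\<^sub>R v\<close> bounds the quotient uniformly in \<open>k\<close>.\<close>
    obtain z where z: "f (x + s k *\<^sub>R v) - f (x + 0 *\<^sub>R v) = (s k - 0) * f' (x + z *\<^sub>R v) v"
      using MVT2[OF s(1)[of k], of "\<lambda>t. f (x + t *\<^sub>R v)" "\<lambda>t. f' (x + t *\<^sub>R v) v"] line by auto
    then have "q k x = f' (x + z *\<^sub>R v) v"
      using s(1)[of k] by (simp add: q_def field_simps)
    then show ?thesis using M True by simp
  next
    case False
    have "norm x \<le> norm (x + s k *\<^sub>R v) + norm v"
    proof -
      have "norm x \<le> norm (x + s k *\<^sub>R v) + norm (s k *\<^sub>R v)"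
        by (metis add_diff_cancel_right' norm_triangle_ineq4)
      also have "norm (s k *\<^sub>R v) \<le> norm v" using s[of k] by (simp add: mult_left_le_one_le)
      finally show ?thesis by simp
    qed
    then have "x + s k *\<^sub>R v \<notin> K" "x \<notin> K"
      using False bspec[OF r, of x] bspec[OF r, of "x + s k *\<^sub>R v"] norm_ge_zero[of v] by (auto simp: L_def)
    then show ?thesis using K(2) False by (simp add: q_def)
  qed
  have lim: "(\<lambda>k. q k x) \<longlonglongrightarrow> f' x v" for x
  proof -
    have "((\<lambda>h. (f (x + h *\<^sub>R v) - f x) / h) \<longlongrightarrow> f' x v) (at 0)"
      using line[of x 0] by (simp add: DERIV_def)
    moreover have "filterlim s (at 0) sequentially"
      unfolding filterlim_at using s(1) LIMSEQ_inverse_real_of_nat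
      by (auto simp: s_def[abs_def] inverse_eq_divide intro!: always_eventually)
    ultimately show ?thesis unfolding q_def by (rule filterlim_compose)
  qed
  have fmeas: "f \<in> borel_measurable borel"
    using fcont by (rule borel_measurable_continuous_onI)
  have fint: "integrable lborel f"
    by (rule integrable_compact_support[of UNIV K]) (use K fcont in auto)
  have q0: "(LINT x|lborel. q k x) = 0" for k
  proof -
    have "integrable (distr lborel borel ((+) (s k *\<^sub>R v))) f"
      using fint by (simp add: lborel_distr_plus)
    then have "integrable lborel (\<lambda>x. f (x + s k *\<^sub>R v))"
      using fmeas by (subst (asm) integrable_distr_eq) (auto simp: add.commute)
    then show ?thesis
      using fint integral_lborel_translate[OF fmeas] by (simp add: q_def)
  qed
  have "(\<lambda>k. LINT x|lborel. q k x) \<longlonglongrightarrow> (LINT x|lborel. f' x v)"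
  proof (rule integral_dominated_convergence[where w = "\<lambda>x. M * indicator L x"])
    show "(\<lambda>x. f' x v) \<in> borel_measurable lborel"
      using borel_measurable_continuous_onI[OF cont] by simp
    show "q k \<in> borel_measurable lborel" for k
      unfolding q_def using fmeas by measurable
    have "emeasure lborel L < \<infinity>" unfolding L_def by (rule emeasure_bounded_finite) simp
    then show "integrable lborel (\<lambda>x. M * indicator L x)"
      by (intro integrable_mult_right integrable_real_indicator) (auto simp: L_def)
  qed (use lim bound in auto)
  then show ?thesis using q0 by (simp add: LIMSEQ_const_iff)
qed

text \<open>This is the divergence theorem for the field \<open>k (norm x) *\<^sub>R x\<close>
  multiplied by \<open>(u x)\<^sup>2\<close>. Each component
  \<open>k (norm x) * (x \<bullet> b) * (u x)\<^sup>2\<close> is differentiated along its own basis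
  vector \<open>b\<close>, the integral of that derivative vanishes, and summation over
  \<open>b\<close> produces the divergence.\<close>

lemma integration_by_parts_radial_field:
  fixes u :: "'a::euclidean_space \<Rightarrow> real" and k k' :: "real \<Rightarrow> real"
  assumes S: "open S" "compact K" "K \<subseteq> S" "0 \<notin> S"
    and u0: "\<And>x. x \<notin> K \<Longrightarrow> u x = 0"
    and du: "\<And>x. x \<in> S \<Longrightarrow> (u has_derivative u' x) (at x)"
    and cu': "\<And>v. continuous_on S (\<lambda>x. u' x v)"
    and dk: "\<And>x. x \<in> S \<Longrightarrow> (k has_real_derivative k' (norm x)) (at (norm x))"
    and ck': "continuous_on S (\<lambda>x. k' (norm x))"
  shows "2 * (LINT x|lborel. k (norm x) * u x * u' x x) =
    - (LINT x|lborel. (norm x * k' (norm x) + real DIM('a) * k (norm x)) * (u x)\<^sup>2)"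
proof -
  have cu: "continuous_on S u"
    using has_derivative_continuous[OF du] by (simp add: continuous_at_imp_continuous_on)
  have ck: "continuous_on S (\<lambda>x. k (norm x))"
  proof (rule continuous_at_imp_continuous_on, rule ballI)
    fix x assume "x \<in> S"
    then show "isCont (\<lambda>x. k (norm x)) x"
      using dk DERIV_isCont by (intro isCont_o2[of x norm k]) auto
  qed
  \<comment> \<open>The product rule is available on \<open>S\<close> only, so its result is cut off
    to 0 outside \<open>K\<close>, where the differentiated function vanishes on an open
    set.\<close>
  define D where "D b x = (if x \<in> K then k' (norm x) * (x \<bullet> b / norm x) * (x \<bullet> b) * (u x)\<^sup>2
     + k (norm x) * (u x)\<^sup>2 * (b \<bullet> b) + 2 * k (norm x) * (x \<bullet> b) * u x * u' x b else 0)" for b x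
  have D: "(LINT x|lborel. D b x) = 0" "integrable lborel (D b)" for b
  proof -
    define f where "f x = k (norm x) * (x \<bullet> b) * (u x)\<^sup>2" for x
    have f0: "f x = 0" if "x \<notin> K" for x using u0 that by (simp add: f_def)
    define f' where "f' x v = (if x \<in> K then k' (norm x) * (x \<bullet> v / norm x) * (x \<bullet> b) * (u x)\<^sup>2
     + k (norm x) * (u x)\<^sup>2 * (v \<bullet> b) + 2 * k (norm x) * (x \<bullet> b) * u x * u' x v else 0)" for x v
    have df: "(f has_derivative f' x) (at x)" for x
    proof (cases "x \<in> K")
      case True
      then have xS: "x \<in> S" and x0: "x \<noteq> 0" using S by auto
      have "((\<lambda>x. k (norm x)) has_derivative (\<lambda>v. k' (norm x) * (x \<bullet> v / norm x))) (at x)"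
        by (rule has_derivative_eq_rhs, rule DERIV_compose_FDERIV[where g = norm, OF dk[OF xS]],
            rule has_derivative_norm[OF x0])
           (simp add: fun_eq_iff sgn_div_norm inner_commute divide_inverse mult.commute)
      note this[derivative_intros] and du[OF xS, derivative_intros]
      show ?thesis unfolding f_def
        by (rule derivative_eq_intros refl)+
           (use True in \<open>auto simp: fun_eq_iff f'_def algebra_simps power2_eq_square\<close>)
    next
      case False
      then have "f' x = (\<lambda>_. 0)" by (auto simp: f'_def)
      then show ?thesis
        using has_derivative_zero_outside[of K f x] S f0 False by (simp add: compact_imp_closed)
    qed
    have Df: "D b x = f' x b" for x by (simp add: D_def f'_def)
    have off: "D b x = 0" if "x \<notin> K" for x using that by (simp add: D_def)
    have "continuous_on S (\<lambda>x. k' (norm x) * (x \<bullet> b / norm x) * (x \<bullet> b) * (u x)\<^sup>2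
     + k (norm x) * (u x)\<^sup>2 * (b \<bullet> b) + 2 * k (norm x) * (x \<bullet> b) * u x * u' x b)"
      using S by (intro continuous_intros ck ck' cu cu') auto
    then have cD: "continuous_on S (D b)"
      by (rule continuous_on_eq) (auto simp: D_def u0)
    show "integrable lborel (D b)"
      by (rule integrable_compact_support[of S K]) (use S cD off in auto)
    have "continuous_on UNIV (D b)"
      by (rule continuous_on_compact_support[of S K]) (use S cD off in auto)
    then have "continuous_on UNIV (\<lambda>x. f' x b)" by (simp add: Df)
    from integral_directional_derivative_eq_0[of f f' b K, OF df this S(2) f0]
    show "(LINT x|lborel. D b x) = 0" by (simp add: Df)
  qed
  \<comment> \<open>The sum of the \<open>(x \<bullet> b)\<^sup>2\<close> is the squared norm, which
    yields the radial term \<open>norm x * k' (norm x)\<close>; the \<open>b \<bullet> b\<close>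
    give the dimension, and linearity assembles the directional derivatives into
    \<open>u' x x\<close>.\<close>
  have sumD: "(\<Sum>b\<in>Basis. D b x) = (norm x * k' (norm x) + real DIM('a) * k (norm x)) * (u x)\<^sup>2
      + 2 * (k (norm x) * u x * u' x x)" for x
  proof (cases "x \<in> K")
    case True
    then have xS: "x \<in> S" and x0: "x \<noteq> 0" using S by auto
    interpret L: bounded_linear "u' x"
      using du xS has_derivative_bounded_linear by blast
    have "u' x x = u' x (\<Sum>b\<in>Basis. (x \<bullet> b) *\<^sub>R b)" by (simp add: euclidean_representation)
    also have "\<dots> = (\<Sum>b\<in>Basis. (x \<bullet> b) * u' x b)" by (simp add: L.sum L.scaleR)
    finally have e1: "u' x x = (\<Sum>b\<in>Basis. (x \<bullet> b) * u' x b)" .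
    have e2: "(\<Sum>b\<in>Basis. (x \<bullet> b) * (x \<bullet> b)) = norm x * norm x"
      using euclidean_inner[of x x] by (simp add: power2_norm_eq_inner power2_eq_square[symmetric])
    have "(\<Sum>b\<in>Basis. D b x) =
       (\<Sum>b\<in>Basis. (k' (norm x) * (u x)\<^sup>2 / norm x) * ((x \<bullet> b) * (x \<bullet> b)))
     + (\<Sum>b\<in>(Basis::'a set). k (norm x) * (u x)\<^sup>2)
     + (\<Sum>b\<in>Basis. (2 * k (norm x) * u x) * ((x \<bullet> b) * u' x b))"
      using True unfolding sum.distrib[symmetric]
      by (intro sum.cong) (auto simp: D_def)
    also have "\<dots> = (k' (norm x) * (u x)\<^sup>2 / norm x) * (norm x * norm x)
      + DIM('a) * (k (norm x) * (u x)\<^sup>2) + (2 * k (norm x) * u x) * u' x x"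
      unfolding e1 e2[symmetric] sum_distrib_left[symmetric] by simp
    finally show ?thesis using x0 by (simp add: algebra_simps)
  next
    case False
    then show ?thesis using u0 by (simp add: D_def)
  qed
  have i1: "integrable lborel (\<lambda>x. (norm x * k' (norm x) + real DIM('a) * k (norm x)) * (u x)\<^sup>2)"
    by (rule integrable_compact_support[of S K])
       (use S u0 in \<open>auto intro!: continuous_intros ck ck' cu\<close>)
  \<comment> \<open>Continuity of \<open>u'\<close> is assumed for fixed directions only, so the
    moving direction \<open>x\<close> is expanded in the basis.\<close>
  have "continuous_on S (\<lambda>x. \<Sum>b\<in>Basis. (x \<bullet> b) * u' x b)"
    by (intro continuous_intros cu')
  then have cux: "continuous_on S (\<lambda>x. u' x x)"
  proof (rule continuous_on_eq)
    fix x assume "x \<in> S"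
    then interpret L: bounded_linear "u' x"
      using du has_derivative_bounded_linear by blast
    have "(\<Sum>b\<in>Basis. (x \<bullet> b) * u' x b) = u' x (\<Sum>b\<in>Basis. (x \<bullet> b) *\<^sub>R b)"
      by (simp add: L.sum L.scaleR)
    then show "(\<Sum>b\<in>Basis. (x \<bullet> b) * u' x b) = u' x x" by (simp add: euclidean_representation)
  qed
  have i2: "integrable lborel (\<lambda>x. k (norm x) * u x * u' x x)"
    by (rule integrable_compact_support[of S K])
       (use S u0 in \<open>auto intro!: continuous_intros ck cu cux\<close>)
  have "0 = (\<Sum>b\<in>Basis. (LINT x|lborel. D b x))" using D(1) by simp
  also have "\<dots> = (LINT x|lborel. (\<Sum>b\<in>Basis. D b x))"
    by (rule Bochner_Integration.integral_sum[symmetric]) (rule D)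
  also have "\<dots> = (LINT x|lborel. (norm x * k' (norm x) + real DIM('a) * k (norm x)) * (u x)\<^sup>2)
      + 2 * (LINT x|lborel. k (norm x) * u x * u' x x)"
    unfolding sumD using i1 i2 by simp
  finally show ?thesis by simp
qed

section \<open>Radial calculus in the ball model\<close>

lemma open_radial_interval: "open (radial_interval R)"
proof -
  have "radial_interval R = {0<..} \<inter> ereal -` {..<R}"
    by (auto simp: radial_interval_def)
  moreover have "open (ereal -` {..<R})"
    by (intro open_vimage continuous_on_ereal continuous_on_id open_lessThan)
  ultimately show ?thesis by auto
qed

text \<open>The conformal factor is the speed of the hyperbolic distance along a ray. This is why
  \<open>hyp_rho\<close> has a gradient of Riemannian norm 1.\<close>

lemma DERIV_hyp_radius:
  fixes r :: real
  assumes "0 \<le> r" "r < 1"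
  shows "((\<lambda>r. ln ((1 + r) / (1 - r))) has_real_derivative 2 / (1 - r\<^sup>2)) (at r)"
proof -
  have "r\<^sup>2 \<noteq> 1" using assms by (simp add: power2_eq_1_iff)
  then show ?thesis using assms
    by (auto intro!: derivative_eq_intros simp: divide_simps) (auto simp: algebra_simps power2_eq_square)
qed

lemma norm_sq_less_1: "norm x < 1 \<Longrightarrow> (norm x)\<^sup>2 < 1"
  by (simp add: power_less_one_iff)

lemma hyp_rho_pos: "norm x < 1 \<Longrightarrow> x \<noteq> 0 \<Longrightarrow> 0 < hyp_rho x"
  using zero_less_norm_iff[of x] unfolding hyp_rho_def
  by (intro ln_gt_zero) (simp add: less_divide_eq)

lemma has_derivative_hyp_rho:
  assumes "norm x < 1" "x \<noteq> 0"
  shows "(hyp_rho has_derivative (\<lambda>h. 2 / (1 - (norm x)\<^sup>2) * (x \<bullet> h / norm x))) (at x)"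
proof -
  have "((\<lambda>x. ln ((1 + norm x) / (1 - norm x))) has_derivative
      (\<lambda>h. 2 / (1 - (norm x)\<^sup>2) * (x \<bullet> h / norm x))) (at x)"
    by (rule has_derivative_eq_rhs,
        rule DERIV_compose_FDERIV[where g = norm, OF DERIV_hyp_radius[OF norm_ge_zero assms(1)]],
        rule has_derivative_norm[OF assms(2)])
       (simp add: fun_eq_iff sgn_div_norm inner_commute divide_inverse mult.commute)
  then show ?thesis by (simp add: hyp_rho_def[abs_def])
qed

lemma continuous_on_hyp_rho:
  assumes "S \<subseteq> ball 0 1"
  shows "continuous_on S hyp_rho"
proof -
  have "1 - norm x \<noteq> 0" "(1 + norm x) / (1 - norm x) \<noteq> 0" if "x \<in> S" for x
    using assms that norm_ge_zero[of x] by (auto simp: subset_iff add_nonneg_eq_0_iff)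
  then show ?thesis
    unfolding hyp_rho_def[abs_def] by (intro continuous_intros ballI) auto
qed

lemma open_hyp_ball: "open (hyp_ball R)"
proof -
  have "open (ball 0 1 \<inter> (\<lambda>x. ereal (hyp_rho x)) -` {..<R})"
    by (intro continuous_open_preimage continuous_on_ereal continuous_on_hyp_rho) auto
  also have "ball 0 1 \<inter> (\<lambda>x. ereal (hyp_rho x)) -` {..<R} = hyp_ball R"
    by (auto simp: hyp_ball_def)
  finally show ?thesis .
qed

text \<open>The exponential of \<open>hyp_rho x\<close> is
  \<open>(1 + norm x) / (1 - norm x)\<close>, so hyperbolic functions of the distance are rational
  in the Euclidean norm.\<close>

lemma coth_hyp_rho:
  assumes "norm x < 1" "x \<noteq> 0"
  shows "cosh (hyp_rho x) / sinh (hyp_rho x) = (1 + (norm x)\<^sup>2) / (2 * norm x)"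
proof -
  have p: "0 < (1 + norm x) / (1 - norm x)" using assms by (simp add: add_pos_nonneg)
  have "1 + norm x \<noteq> 0" using norm_ge_zero[of x] by linarith
  then
  show ?thesis
    unfolding hyp_rho_def sinh_ln_real[OF p] cosh_ln_real[OF p] using assms
    by (simp add: divide_simps) (auto simp: algebra_simps power2_eq_square)
qed

text \<open>The difference vanishes at 0 and has derivative \<open>r * sinh r\<close>. For positive
  \<open>r\<close> this is \<open>coth r \<ge> 1 / r\<close>, the sign of the correction
  term.\<close>

lemma sinh_le_mult_cosh:
  fixes r :: real
  assumes "0 \<le> r"
  shows "sinh r \<le> r * cosh r"
proof -
  have "0 * cosh 0 - sinh 0 \<le> r * cosh r - sinh r"
    by (rule DERIV_nonneg_imp_nondecreasing[OF assms])
       (auto intro!: exI derivative_eq_intros)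
  then show ?thesis by simp
qed

lemma frechet_derivative_eq_euclidean_grad:
  assumes "f differentiable (at x)"
  shows "frechet_derivative f (at x) v = euclidean_grad f x \<bullet> v"
proof -
  interpret L: bounded_linear "frechet_derivative f (at x)"
    using assms frechet_derivative_works has_derivative_bounded_linear by blast
  have "frechet_derivative f (at x) v = frechet_derivative f (at x) (\<Sum>i\<in>UNIV. v $ i *\<^sub>R axis i 1)"
    using basis_expansion[of v] by (simp add: scalar_mult_eq_scaleR)
  also have "\<dots> = (\<Sum>i\<in>UNIV. v $ i * frechet_derivative f (at x) (axis i 1))"
    by (simp add: L.sum L.scaleR)
  finally show ?thesis
    by (simp add: euclidean_grad_def inner_vec_def mult.commute)
qed

lemma euclidean_grad_hyp_rho:
  assumes "norm x < 1" "x \<noteq> 0"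
  shows "euclidean_grad hyp_rho x = (2 / (1 - (norm x)\<^sup>2) / norm x) *\<^sub>R x"
  using frechet_derivative_at[OF has_derivative_hyp_rho[OF assms]]
  by (simp add: euclidean_grad_def vec_eq_iff inner_axis fun_eq_iff)
     (metis inner_axis real_inner_1_right)

lemma hyp_norm_sq: "(hyp_norm x v)\<^sup>2 = hyp_inner x v v"
  by (simp add: hyp_norm_def hyp_inner_def)

lemma conformal_factor_cancel: "t \<noteq> 0 \<Longrightarrow> (2 / t)\<^sup>2 * (t / 2)\<^sup>2 = 1" for t :: real
  by (simp add: power_divide)

text \<open>Each gradient carries one inverse squared conformal factor, and the metric cancels one
  of the two.\<close>

lemma hyp_inner_hyp_grad:
  assumes "norm x < 1"
  shows "hyp_inner x (hyp_grad f x) (hyp_grad h x) =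
    ((1 - (norm x)\<^sup>2) / 2)\<^sup>2 * (euclidean_grad f x \<bullet> euclidean_grad h x)"
proof -
  have "(2 / (1 - (norm x)\<^sup>2))\<^sup>2 * ((1 - (norm x)\<^sup>2) / 2)\<^sup>2 = 1"
    using norm_sq_less_1[OF assms] by (intro conformal_factor_cancel) simp
  then have "(2 / (1 - (norm x)\<^sup>2))\<^sup>2 * (((1 - (norm x)\<^sup>2) / 2)\<^sup>2 *
      (((1 - (norm x)\<^sup>2) / 2)\<^sup>2 * z)) = ((1 - (norm x)\<^sup>2) / 2)\<^sup>2 * z" for z
    unfolding mult.assoc[symmetric] by simp
  then show ?thesis
    by (simp only: hyp_inner_def hyp_grad_def inner_scaleR_left inner_scaleR_right)
qed

section \<open>Hyperbolic integrals as Lebesgue integrals\<close>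

lemma
  fixes F :: "real ^ 'n \<Rightarrow> real"
  assumes S: "open S" "compact K" "K \<subseteq> S" "S \<subseteq> hyp_ball R"
    and F: "continuous_on S F" "\<And>x. x \<notin> K \<Longrightarrow> F x = 0"
  shows set_integrable_hyp_volume: "set_integrable hyp_volume (hyp_ball R) F"
    and set_lebesgue_integral_hyp_volume: "(LINT x:hyp_ball R|hyp_volume. F x) =
      (LINT x|lborel. (2 / (1 - (norm x)\<^sup>2)) ^ CARD('n) * F x)"
proof -
  \<comment> \<open>The indicator keeps \<open>d\<close> nonnegative: outside the closed unit ball
    the power is negative for odd \<open>CARD('n)\<close>.\<close>
  define d where "d x = indicator (ball 0 1) x * (2 / (1 - (norm x)\<^sup>2)) ^ CARD('n)"
    for x :: "real ^ 'n"
  have S1: "norm x < 1" if "x \<in> S" for x using that S(4) by (auto simp: hyp_ball_def)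
  have d0: "0 \<le> d x" for x
    using norm_sq_less_1[of x] by (cases "norm x < 1") (auto simp: d_def indicator_def)
  have dm: "d \<in> borel_measurable lborel"
    unfolding d_def[abs_def] 
    by (intro borel_measurable_times borel_measurable_power borel_measurable_divide
        borel_measurable_diff borel_measurable_norm borel_measurable_indicator) auto
  have vol: "hyp_volume = density lborel (\<lambda>x. ennreal (d x))"
    unfolding hyp_volume_def
    by (intro arg_cong[where f = "density lborel"] ext) (simp add: d_def indicator_def)
  have iF: "indicator (hyp_ball R) x *\<^sub>R F x = F x" for x
    using S F(2)[of x] by (cases "x \<in> K") (auto simp: indicator_def)
  have wF: "d x * F x = (2 / (1 - (norm x)\<^sup>2)) ^ CARD('n) * F x" for x
    using S S1 F(2)[of x] by (cases "x \<in> K") (auto simp: d_def indicator_def subset_iff)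
  have cF: "continuous_on UNIV F"
    by (rule continuous_on_compact_support[of S K]) (use S F in auto)
  then have Fm: "F \<in> borel_measurable lborel"
    by (simp add: borel_measurable_continuous_onI)
  have "continuous_on S (\<lambda>x. (2 / (1 - (norm x)\<^sup>2)) ^ CARD('n) * F x)"
    by (intro continuous_intros F) (use norm_sq_less_1[OF S1] in force)
  then have "integrable lborel (\<lambda>x. (2 / (1 - (norm x)\<^sup>2)) ^ CARD('n) * F x)"
    by (rule integrable_compact_support[OF S(1-3)]) (simp add: F)
  then show "set_integrable hyp_volume (hyp_ball R) F"
    unfolding set_integrable_def iF vol using dm d0 Fm
    by (subst integrable_density) (auto simp: wF)
  show "(LINT x:hyp_ball R|hyp_volume. F x) =
      (LINT x|lborel. (2 / (1 - (norm x)\<^sup>2)) ^ CARD('n) * F x)"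
    unfolding set_lebesgue_integral_def iF vol using dm d0 Fm
    by (subst integral_density) (auto simp: wF)
qed

section \<open>The Bessel equation in Riccati form\<close>

text \<open>Dividing the expanded Bessel equation by \<open>r ^ m\<close> and by
  \<open>\<phi> r\<close> leaves a first-order equation for \<open>V\<close> times the logarithmic
  derivative; the quotient rule contributes the quadratic term.\<close>

lemma bessel_pair_DERIV:
  assumes V: "V C1_differentiable_on radial_interval R"
    and bessel: "bessel_pair R (\<lambda>r. r ^ m * V r) (\<lambda>r. r ^ m * W r) \<phi>"
    and r: "r \<in> radial_interval R"
  shows "((\<lambda>s. V s * (deriv \<phi> s / \<phi> s)) has_real_derivative
    - W r - m / r * (V r * (deriv \<phi> r / \<phi> r)) - V r * (deriv \<phi> r / \<phi> r)\<^sup>2) (at r)"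
proof -
  have r0: "0 < r" using r by (simp add: radial_interval_def)
  have b: "\<phi> r > 0" "\<phi> differentiable (at r)" "deriv \<phi> differentiable (at r)"
    "deriv (\<lambda>s. s ^ m * V s * deriv \<phi> s) r + r ^ m * W r * \<phi> r = 0"
    using bessel r by (auto simp: bessel_pair_def)
  obtain V' where dV [derivative_intros]: "(V has_real_derivative V') (at r)"
    using V r by (auto simp: C1_differentiable_on_def has_real_derivative_iff_has_vector_derivative)
  have d1 [derivative_intros]: "(\<phi> has_real_derivative deriv \<phi> r) (at r)"
    using b(2) by (simp add: DERIV_deriv_iff_real_differentiable)
  obtain p where d2 [derivative_intros]: "(deriv \<phi> has_real_derivative p) (at r)"
    using b(3) real_differentiable_def by blast
  \<comment> \<open>The power rule is written with \<open>r ^ m * (m / r)\<close> instead of the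
    exponent \<open>m - 1\<close>. This is correct for \<open>m = 0\<close> too, and lets the
    positive factor \<open>r ^ m\<close> be cancelled.\<close>
  have "((\<lambda>s. s ^ m * V s * deriv \<phi> s) has_real_derivative
      r ^ m * (m / r * V r * deriv \<phi> r + V' * deriv \<phi> r + V r * p)) (at r)"
    by (rule derivative_eq_intros refl)+
       (use r0 in \<open>cases m; simp add: field_simps\<close>)
  then have "r ^ m * (m / r * V r * deriv \<phi> r + V' * deriv \<phi> r + V r * p + W r * \<phi> r) = 0"
    using b(4) by (simp add: DERIV_imp_deriv algebra_simps)
  then have eq: "V' * deriv \<phi> r + V r * p = - (m / r * V r * deriv \<phi> r) - W r * \<phi> r"
    using r0 by simp
  have "((\<lambda>s. V s * (deriv \<phi> s / \<phi> s)) has_real_derivative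
      (V' * deriv \<phi> r + V r * p) / \<phi> r - V r * (deriv \<phi> r / \<phi> r)\<^sup>2) (at r)"
    using DERIV_mult[OF dV DERIV_divide[OF d2 d1]] b(1)
    by (auto elim!: DERIV_cong simp: field_simps power2_eq_square)
  then show ?thesis unfolding eq
    by (rule DERIV_cong) (use b(1) r0 in \<open>auto simp: field_simps\<close>)
qed

section \<open>The weighted identity\<close>

locale hyp_bessel_pair =
  fixes R :: ereal and V W \<phi> :: "real \<Rightarrow> real" and u :: "real ^ 'n \<Rightarrow> real"
  assumes V_C1: "V C1_differentiable_on radial_interval R"
    and W_C1: "W C1_differentiable_on radial_interval R"
    and bessel: "bessel_pair R (\<lambda>r. r ^ (CARD('n) - 1) * V r) (\<lambda>r. r ^ (CARD('n) - 1) * W r) \<phi>"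
    and u: "u \<in> test_functions (hyp_ball R - {0})"
begin

definition S :: "(real ^ 'n) set" where "S = hyp_ball R - {0}"
definition K :: "(real ^ 'n) set" where "K = closure {x. u x \<noteq> 0}"
definition g :: "real \<Rightarrow> real" where "g r = deriv \<phi> r / \<phi> r"

lemma in_S:
  assumes "x \<in> S"
  shows "norm x < 1" "x \<noteq> 0" "hyp_rho x \<in> radial_interval R" "0 < 1 - (norm x)\<^sup>2"
  using assms hyp_rho_pos[of x] norm_sq_less_1[of x]
  by (auto simp: S_def hyp_ball_def radial_interval_def)

lemma S_K: "open S" "compact K" "K \<subseteq> S" "S \<subseteq> hyp_ball R" "0 \<notin> S" "S \<subseteq> ball 0 1"
proof -
  show "open S" unfolding S_def by (rule open_delete[OF open_hyp_ball])
  show "compact K" "K \<subseteq> S" using u by (simp_all add: S_def K_def test_functions_def)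
  show "S \<subseteq> hyp_ball R" "0 \<notin> S" "S \<subseteq> ball 0 1" by (auto simp: S_def hyp_ball_def)
qed

lemma u_off: "x \<notin> K \<Longrightarrow> u x = 0"
  using closure_subset[of "{x. u x \<noteq> 0}"] by (auto simp: K_def)

lemma u_Ck: "Ck_on (Suc 0) S u"
  using u unfolding test_functions_def smooth_on_def S_def by blast

lemma u_diff: "x \<in> S \<Longrightarrow> (u has_derivative frechet_derivative u (at x)) (at x)"
  using u_Ck frechet_derivative_works by auto

lemma cont_du: "continuous_on S (\<lambda>x. frechet_derivative u (at x) v)"
  using u_Ck by simp

lemma cont_u: "continuous_on S u"
  using has_derivative_continuous[OF u_diff] by (simp add: continuous_at_imp_continuous_on)

lemma cont_grad: "continuous_on S (euclidean_grad u)"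
  unfolding euclidean_grad_def[abs_def] by (intro continuous_on_vec_lambda cont_du)

lemma grad_off:
  assumes "x \<notin> K"
  shows "euclidean_grad u x = 0"
proof -
  have "(u has_derivative (\<lambda>_. 0)) (at x)"
    using compact_imp_closed[OF S_K(2)] u_off assms by (rule has_derivative_zero_outside)
  then have "frechet_derivative u (at x) = (\<lambda>_. 0)"
    by (rule frechet_derivative_at[symmetric])
  then show ?thesis by (simp add: euclidean_grad_def vec_eq_iff)
qed

lemma cont_radial:
  assumes "\<And>r. r \<in> radial_interval R \<Longrightarrow> isCont f r"
  shows "continuous_on S (\<lambda>x. f (hyp_rho x))"
  by (rule continuous_on_compose2[OF continuous_at_imp_continuous_on[of "radial_interval R" f]])
     (use assms in_S(3) S_K(6) continuous_on_hyp_rho in auto)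

lemma isCont_C1: "f C1_differentiable_on radial_interval R \<Longrightarrow> r \<in> radial_interval R \<Longrightarrow> isCont f r"
  by (auto simp: C1_differentiable_on_def dest: has_vector_derivative_continuous)

lemma
  assumes "r \<in> radial_interval R"
  shows phi_pos: "0 < \<phi> r" and isCont_phi: "isCont \<phi> r" and isCont_deriv_phi: "isCont (deriv \<phi>) r"
  using bessel assms by (auto simp: bessel_pair_def dest: differentiable_imp_continuous_within)

lemma isCont_g: "r \<in> radial_interval R \<Longrightarrow> isCont g r"
  unfolding g_def[abs_def] using phi_pos[of r]
  by (intro continuous_intros isCont_phi isCont_deriv_phi) auto

lemmas cont_V = cont_radial[OF isCont_C1[OF V_C1]]
lemmas cont_W = cont_radial[OF isCont_C1[OF W_C1]]
lemmas cont_g = cont_radial[OF isCont_g]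

section \<open>The integrands: support, continuity and integrability\<close>

definition a where "a x = V (hyp_rho x) * hyp_inner x (hyp_grad u x) (hyp_grad u x)"
definition b where "b x = V (hyp_rho x) * (g (hyp_rho x))\<^sup>2 * (u x)\<^sup>2"
text \<open>The mixed term of the expanded square; it is the only one that integration by parts has
  to transform.\<close>

definition c where "c x = V (hyp_rho x) * g (hyp_rho x) * u x * hyp_inner x (hyp_grad hyp_rho x) (hyp_grad u x)"
definition d\<^sub>1 where "d\<^sub>1 x = (W (hyp_rho x) + V (hyp_rho x) * (g (hyp_rho x))\<^sup>2) * (u x)\<^sup>2"
text \<open>The quotient is \<open>coth \<rho> - 1 / \<rho>\<close>. Multiplied by
  \<open>N - 1\<close>, it is the excess of the mean curvature of a hyperbolic sphere over that of a
  Euclidean sphere of the same radius.\<close>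

definition d\<^sub>2 where "d\<^sub>2 x = V (hyp_rho x) * g (hyp_rho x)
  * ((hyp_rho x * cosh (hyp_rho x) - sinh (hyp_rho x)) / (hyp_rho x * sinh (hyp_rho x))) * (u x)\<^sup>2"

lemma integrand_off:
  assumes "x \<notin> K"
  shows "a x = 0" "b x = 0" "c x = 0" "d\<^sub>1 x = 0" "d\<^sub>2 x = 0"
  using u_off[OF assms] grad_off[OF assms]
  by (simp_all add: a_def b_def c_def d\<^sub>1_def d\<^sub>2_def hyp_grad_def hyp_inner_def)

lemma cont_integrand:
  "continuous_on S a" "continuous_on S b" "continuous_on S c" "continuous_on S d\<^sub>1" "continuous_on S d\<^sub>2"
proof -
  have "continuous_on S (\<lambda>x. V (hyp_rho x) * (((1 - (norm x)\<^sup>2) / 2)\<^sup>2 *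
      (euclidean_grad u x \<bullet> euclidean_grad u x)))"
    by (intro continuous_intros cont_V cont_grad) auto
  then show "continuous_on S a"
    by (rule continuous_on_eq) (simp add: a_def hyp_inner_hyp_grad in_S)
  show "continuous_on S b"
    unfolding b_def[abs_def] by (intro continuous_intros cont_V cont_g cont_u)
  show "continuous_on S d\<^sub>1"
    unfolding d\<^sub>1_def[abs_def] by (intro continuous_intros cont_V cont_W cont_g cont_u)
  have "continuous_on S (\<lambda>x. V (hyp_rho x) * g (hyp_rho x) * u x * (((1 - (norm x)\<^sup>2) / 2)\<^sup>2 *
      ((2 / (1 - (norm x)\<^sup>2) / norm x) *\<^sub>R x \<bullet> euclidean_grad u x)))"
    by (intro continuous_intros cont_V cont_g cont_u cont_grad) (use in_S in force)+
  then show "continuous_on S c"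
    by (rule continuous_on_eq) (simp add: c_def hyp_inner_hyp_grad euclidean_grad_hyp_rho in_S)
  show "continuous_on S d\<^sub>2"
    unfolding d\<^sub>2_def[abs_def]
    by (intro continuous_intros cont_V cont_g cont_u continuous_on_hyp_rho S_K)
       (auto dest!: in_S(3) simp: radial_interval_def)
qed

lemmas set_integrable = set_integrable_hyp_volume[OF S_K(1-4)]
lemmas set_lebesgue = set_lebesgue_integral_hyp_volume[OF S_K(1-4)]

lemma set_integrable_integrand:
  "set_integrable hyp_volume (hyp_ball R) a" "set_integrable hyp_volume (hyp_ball R) b"
  "set_integrable hyp_volume (hyp_ball R) c" "set_integrable hyp_volume (hyp_ball R) d\<^sub>1"
  "set_integrable hyp_volume (hyp_ball R) d\<^sub>2"
  by (intro set_integrable cont_integrand integrand_off; assumption)+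

text \<open>
  The divergence of the field \<open>V(\<rho>) (\<phi>'/\<phi>)(\<rho>) \<nabla>\<rho>\<close>, integrated against \<open>u\<^sup>2\<close>.  In Euclidean terms
  the field is \<open>k(|x|) x\<close> with the profile \<open>k\<close> below, and \<open>coth \<rho> = (1 + |x|\<^sup>2) / (2|x|)\<close>.
\<close>

lemma cross_term:
  "2 * (LINT x:hyp_ball R|hyp_volume. c x) =
    (LINT x:hyp_ball R|hyp_volume. d\<^sub>1 x) - (real CARD('n) - 1) * (LINT x:hyp_ball R|hyp_volume. d\<^sub>2 x)"
proof -
  define N where "N = CARD('n)"
  define m where "m = N - 1"
  have Nm: "N = Suc m" by (simp add: N_def m_def)
  define rho where "rho r = ln ((1 + r) / (1 - r))" for r :: real
  have rho: "hyp_rho x = rho (norm x)" for x :: "real ^ 'n" by (simp add: hyp_rho_def rho_def)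
  define f where "f r = V r * g r" for r
  define f' where "f' r = - W r - m / r * f r - V r * (g r)\<^sup>2" for r
  define w where "w r = 2 / (1 - r\<^sup>2)" for r :: real
  \<comment> \<open>The volume gives \<open>w ^ N\<close>, the inner product of gradients removes
    two factors \<open>w\<close>, and the gradient of \<open>hyp_rho\<close> restores one and
    contributes \<open>x / norm x\<close>. What remains is \<open>w ^ m / r\<close> times the
    derivative of \<open>u\<close> along \<open>x\<close>.\<close>
  define k where "k r = f (rho r) * w r ^ m / r" for r
  \<comment> \<open>Computed from \<open>rho' = w\<close> and \<open>w' = w\<^sup>2 * r\<close>, so
    that \<open>w ^ m\<close> has derivative \<open>m * w ^ N * r\<close>.\<close>
  define k' where "k' r = f' (rho r) * w r ^ N / r + f (rho r) * m * w r ^ N - f (rho r) * w r ^ m / r\<^sup>2" for r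
  have dk: "(k has_real_derivative k' (norm x)) (at (norm x))" if x: "x \<in> S" for x
  proof -
    have x1: "norm x < 1" "0 < norm x" using in_S[OF x] by auto
    have w0: "1 - (norm x)\<^sup>2 \<noteq> 0" using in_S(4)[OF x] by simp
    have "(f has_real_derivative f' (rho (norm x))) (at (rho (norm x)))"
      using bessel_pair_DERIV[OF V_C1 bessel in_S(3)[OF x]]
      by (simp add: f_def[abs_def] f'_def g_def rho m_def N_def)
    moreover have "(rho has_real_derivative w (norm x)) (at (norm x))"
      using DERIV_hyp_radius[of "norm x"] x1 by (simp add: rho_def[abs_def] w_def)
    ultimately have d1: "((\<lambda>r. f (rho r)) has_real_derivative f' (rho (norm x)) * w (norm x)) (at (norm x))"
      by (rule DERIV_chain2)
    have "(w has_real_derivative (w (norm x))\<^sup>2 * norm x) (at (norm x))"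
      unfolding w_def[abs_def]
      by (rule derivative_eq_intros refl w0)+ (use w0 in \<open>simp add: divide_simps power2_eq_square\<close>)
    from DERIV_power[OF this, of m]
    have "((\<lambda>r. w r ^ m) has_real_derivative m * w (norm x) ^ N * norm x) (at (norm x))"
      by (rule DERIV_cong) (cases m; simp add: Nm power2_eq_square)
    from DERIV_divide[OF DERIV_mult[OF d1 this] DERIV_ident]
    show ?thesis
      unfolding k_def[abs_def]
      by (rule DERIV_cong) (use x1 in \<open>auto simp: k'_def Nm field_simps power2_eq_square\<close>)
  qed
  have cont_k': "continuous_on S (\<lambda>x. k' (norm x))"
    unfolding k'_def f'_def f_def w_def rho[symmetric]
    by (intro continuous_intros cont_V cont_W cont_g continuous_on_hyp_rho S_K)
       (use in_S in \<open>force simp: radial_interval_def\<close>)+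
  have parts: "2 * (LINT x|lborel. k (norm x) * u x * frechet_derivative u (at x) x) =
    - (LINT x|lborel. (norm x * k' (norm x) + real DIM(real ^ 'n) * k (norm x)) * (u x)\<^sup>2)"
    by (rule integration_by_parts_radial_field[OF S_K(1-3,5) u_off u_diff cont_du dk cont_k'])
  have lhs: "w (norm x) ^ N * c x = k (norm x) * u x * frechet_derivative u (at x) x" for x
  proof (cases "x \<in> K")
    case True
    then have x: "x \<in> S" using S_K by auto
    have w0: "w (norm x) \<noteq> 0" "1 - (norm x)\<^sup>2 = 2 / w (norm x)"
      using in_S(4)[OF x] by (auto simp: w_def)
    have "frechet_derivative u (at x) x = euclidean_grad u x \<bullet> x"
      using u_diff[OF x] by (intro frechet_derivative_eq_euclidean_grad differentiableI)
    then show ?thesis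
      using w0(1) in_S(2)[OF x] unfolding c_def hyp_inner_hyp_grad[OF in_S(1)[OF x]]
        euclidean_grad_hyp_rho[OF in_S(1,2)[OF x]] w0(2)
      by (simp add: k_def f_def rho Nm inner_commute field_simps power2_eq_square)
  qed (simp add: u_off integrand_off)
  \<comment> \<open>The term \<open>m / \<rho> * f\<close> contained in \<open>f'\<close> cancels
    the \<open>1 / \<rho>\<close> of \<open>d\<^sub>2\<close>. Only
    \<open>f' + m * coth \<rho> * f\<close> is left, the hyperbolic divergence of the field.\<close>
  have rhs: "w (norm x) ^ N * (d\<^sub>1 x - m * d\<^sub>2 x) =
      - ((norm x * k' (norm x) + real DIM(real ^ 'n) * k (norm x)) * (u x)\<^sup>2)" for x
  proof (cases "x \<in> K")
    case True
    then have x: "x \<in> S" using S_K by auto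
    have "2 / t * t = 2" if "0 < t" for t :: real using that by simp
    then have w0: "w (norm x) * (1 - (norm x)\<^sup>2) = 2"
      unfolding w_def using in_S(4)[OF x] .
    have r0: "norm x \<noteq> 0" "hyp_rho x > 0"
      using in_S[OF x] hyp_rho_pos by auto
    have "(hyp_rho x * cosh (hyp_rho x) - sinh (hyp_rho x)) / (hyp_rho x * sinh (hyp_rho x))
        = cosh (hyp_rho x) / sinh (hyp_rho x) - 1 / hyp_rho x"
      using r0 by (simp add: field_simps)
    also have "\<dots> = (1 + (norm x)\<^sup>2) / (2 * norm x) - 1 / hyp_rho x"
      using coth_hyp_rho in_S[OF x] by simp
    finally have d\<^sub>2: "d\<^sub>2 x = f (hyp_rho x) * ((1 + (norm x)\<^sup>2) / (2 * norm x) - 1 / hyp_rho x) * (u x)\<^sup>2"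
      unfolding d\<^sub>2_def f_def by simp
    have "d\<^sub>1 x - m * d\<^sub>2 x =
        - (f' (hyp_rho x) + m * f (hyp_rho x) * ((1 + (norm x)\<^sup>2) / (2 * norm x))) * (u x)\<^sup>2"
      unfolding d\<^sub>2 by (simp add: d\<^sub>1_def f'_def f_def algebra_simps)
    moreover have "norm x * k' (norm x) + N * k (norm x) =
       w (norm x) ^ N * f' (hyp_rho x) + m * f (hyp_rho x) * w (norm x) ^ m * (w (norm x) * norm x + 1 / norm x)"
      using r0 by (simp add: k'_def k_def Nm rho field_simps power2_eq_square)
    \<comment> \<open>This identity turns the Euclidean divergence into the one with
      \<open>coth \<rho>\<close>; it comes from replacing the numerator of \<open>1 / norm x\<close>
      by half of \<open>w (norm x) * (1 - (norm x)\<^sup>2) = 2\<close>.\<close>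
    moreover have "w (norm x) * norm x + 1 / norm x = w (norm x) * ((1 + (norm x)\<^sup>2) / (2 * norm x))"
    proof -
      have "1 / norm x = w (norm x) * (1 - (norm x)\<^sup>2) / (2 * norm x)"
        unfolding w0 by simp
      show ?thesis
        unfolding \<open>1 / norm x = _\<close> using r0 by (simp add: field_simps power2_eq_square)
    qed
    ultimately show ?thesis
      by (simp add: N_def[symmetric]) (simp add: Nm algebra_simps)
  qed (simp add: u_off integrand_off)
  have "2 * (LINT x:hyp_ball R|hyp_volume. c x) = 2 * (LINT x|lborel. w (norm x) ^ N * c x)"
    by (simp add: set_lebesgue cont_integrand integrand_off w_def N_def)
  also have "\<dots> = (LINT x|lborel. w (norm x) ^ N * (d\<^sub>1 x - m * d\<^sub>2 x))"
    unfolding lhs rhs using parts by simp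
  also have "\<dots> = (LINT x:hyp_ball R|hyp_volume. d\<^sub>1 x - m * d\<^sub>2 x)"
    by (subst set_lebesgue) (auto simp: w_def N_def integrand_off intro!: continuous_intros cont_integrand)
  also have "\<dots> = (LINT x:hyp_ball R|hyp_volume. d\<^sub>1 x) - m * (LINT x:hyp_ball R|hyp_volume. d\<^sub>2 x)"
    using set_integrable_integrand by (subst set_integral_diff) auto
  finally show ?thesis by (simp add: m_def N_def of_nat_diff)
qed

section \<open>Expansion of the square\<close>

text \<open>The coefficients \<open>s\<close> and \<open>t\<close> stay free because the expansion
  serves twice: with \<open>1 / lam\<close> and \<open>lam\<close> in the identity, and as a
  nonnegative quadratic form behind the Cauchy-Schwarz inequality.\<close>

lemma square_term:
  "(LINT x:hyp_ball R|hyp_volume. V (hyp_rho x) *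
      (hyp_norm x ((s * u x * g (hyp_rho x)) *\<^sub>R hyp_grad hyp_rho x - t *\<^sub>R hyp_grad u x))\<^sup>2) =
    s\<^sup>2 * (LINT x:hyp_ball R|hyp_volume. b x) - 2 * s * t * (LINT x:hyp_ball R|hyp_volume. c x)
      + t\<^sup>2 * (LINT x:hyp_ball R|hyp_volume. a x)"
proof -
  have "V (hyp_rho x) * (hyp_norm x ((s * u x * g (hyp_rho x)) *\<^sub>R hyp_grad hyp_rho x - t *\<^sub>R hyp_grad u x))\<^sup>2
      = s\<^sup>2 * b x - 2 * s * t * c x + t\<^sup>2 * a x" (is "?L x = _") for x
  proof (cases "x \<in> K")
    case True
    then have x: "x \<in> S" using S_K by auto
    have "(2 / (1 - (norm x)\<^sup>2))\<^sup>2 * ((1 - (norm x)\<^sup>2) / 2)\<^sup>2 = 1"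
      using in_S(4)[OF x] by (intro conformal_factor_cancel) simp
    moreover have "(q / norm x) *\<^sub>R x \<bullet> (q / norm x) *\<^sub>R x = q\<^sup>2" for q
      using in_S(2)[OF x] by (simp add: dot_square_norm power2_eq_square)
    \<comment> \<open>The eikonal equation for the distance function, which makes the coefficient of
      \<open>s\<^sup>2\<close> exactly \<open>b x\<close>.\<close>
    ultimately have "hyp_inner x (hyp_grad hyp_rho x) (hyp_grad hyp_rho x) = 1"
      unfolding hyp_inner_hyp_grad[OF in_S(1)[OF x]] euclidean_grad_hyp_rho[OF in_S(1,2)[OF x]]
      by (simp only: mult.commute)
    moreover have "hyp_inner x (p *\<^sub>R v - q *\<^sub>R y) (p *\<^sub>R v - q *\<^sub>R y) =
       p\<^sup>2 * hyp_inner x v v - 2 * p * q * hyp_inner x v y + q\<^sup>2 * hyp_inner x y y" for p q v y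
    proof -
      define e where "e = (2 / (1 - (norm x)\<^sup>2))\<^sup>2"
      show ?thesis
        unfolding hyp_inner_def e_def[symmetric]
        by (simp add: inner_diff_left inner_diff_right inner_commute algebra_simps power2_eq_square)
    qed
    ultimately show ?thesis
      by (simp add: hyp_norm_sq a_def b_def c_def) (simp add: algebra_simps power2_eq_square)
  qed (simp add: u_off integrand_off grad_off hyp_grad_def hyp_norm_def hyp_inner_def)
  then show ?thesis using set_integrable_integrand by simp
qed

lemma integrand_a: "V (hyp_rho x) * (hyp_norm x (hyp_grad u x))\<^sup>2 = a x"
  by (simp add: a_def hyp_norm_sq)

lemma integrand_b: "V (hyp_rho x) * ((deriv \<phi> (hyp_rho x))\<^sup>2 / (\<phi> (hyp_rho x))\<^sup>2) * \<bar>u x\<bar>\<^sup>2 = b x"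
  by (simp add: b_def g_def power_divide)

lemma integrand_d\<^sub>1:
  "(W (hyp_rho x) + V (hyp_rho x) * ((deriv \<phi> (hyp_rho x))\<^sup>2 / (\<phi> (hyp_rho x))\<^sup>2)) * \<bar>u x\<bar>\<^sup>2 = d\<^sub>1 x"
  by (simp add: d\<^sub>1_def g_def power_divide)

lemma integrand_d\<^sub>2: "V (hyp_rho x) * (deriv \<phi> (hyp_rho x) / \<phi> (hyp_rho x))
  * ((hyp_rho x * cosh (hyp_rho x) - sinh (hyp_rho x)) / (hyp_rho x * sinh (hyp_rho x))) * \<bar>u x\<bar>\<^sup>2 = d\<^sub>2 x"
  by (simp add: d\<^sub>2_def g_def)

section \<open>The identity and the inequality for a fixed test function\<close>

text \<open>The fourth root balances the two pure terms of the square: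
  \<open>lam\<^sup>2 * A\<close> and \<open>B / lam\<^sup>2\<close> both equal
  \<open>sqrt A * sqrt B\<close>, while the factors of the mixed term cancel.\<close>

lemma uncertainty_identity:
  assumes A: "A = (LINT x:hyp_ball R|hyp_volume. a x)" "0 < A"
    and B: "B = (LINT x:hyp_ball R|hyp_volume. b x)" "0 < B"
    and lam: "lam = root 4 (B / A)"
  shows "sqrt A * sqrt B =
      1 / 2 * (LINT x:hyp_ball R|hyp_volume. d\<^sub>1 x)
      - (real CARD('n) - 1) / 2 * (LINT x:hyp_ball R|hyp_volume. d\<^sub>2 x)
      + 1 / 2 * (LINT x:hyp_ball R|hyp_volume. V (hyp_rho x) *
          (hyp_norm x ((1 / lam * u x * (deriv \<phi> (hyp_rho x) / \<phi> (hyp_rho x))) *\<^sub>R hyp_grad hyp_rho x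
            - lam *\<^sub>R hyp_grad u x))\<^sup>2)"
proof -
  have lam0: "lam > 0" using A B by (simp add: lam)
  have "lam ^ 4 = B / A" using A B by (simp add: lam)
  then have "(lam\<^sup>2)\<^sup>2 = B / A" by (simp add: power_mult[symmetric])
  then have l2: "lam\<^sup>2 = sqrt B / sqrt A"
    by (metis real_sqrt_divide real_sqrt_unique zero_le_power2)
  have "(1 / lam)\<^sup>2 * B + lam\<^sup>2 * A = 2 * (sqrt A * sqrt B)"
    unfolding power_divide l2 using A B by (simp add: field_simps)
  moreover have "2 * (1 / lam) * lam = 2" using lam0 by simp
  moreover define n where "n = real CARD('n) - 1"
  ultimately show ?thesis
    using square_term[of "1 / lam" lam, unfolded g_def] cross_term
    unfolding A(1)[symmetric] B(1)[symmetric] n_def[symmetric] by (simp only:) argo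
qed

text \<open>By \<open>cross_term\<close>, the left-hand side is the integral of \<open>c\<close>
  plus \<open>(N - 1) / 2\<close> times that of \<open>d\<^sub>2\<close>. The former is bounded by
  Cauchy-Schwarz, the latter is nonpositive.\<close>

lemma uncertainty_inequality:
  assumes V: "\<And>r. r \<in> radial_interval R \<Longrightarrow> V r \<ge> 0"
    and g: "\<And>r. r \<in> radial_interval R \<Longrightarrow> deriv \<phi> r / \<phi> r \<le> 0"
  shows "1 / 2 * (LINT x:hyp_ball R|hyp_volume. d\<^sub>1 x) \<le>
    sqrt (LINT x:hyp_ball R|hyp_volume. a x) * sqrt (LINT x:hyp_ball R|hyp_volume. b x)"
proof -
  define A where "A = (LINT x:hyp_ball R|hyp_volume. a x)"
  define B where "B = (LINT x:hyp_ball R|hyp_volume. b x)"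
  define C where "C = (LINT x:hyp_ball R|hyp_volume. c x)"
  \<comment> \<open>The form is the integral of \<open>V\<close> times a squared norm. The sign of
    \<open>V\<close> is known on the radial interval only, but off \<open>K\<close> the integrand is
    zero.\<close>
  have quad: "0 \<le> s\<^sup>2 * B - 2 * s * t * C + t\<^sup>2 * A" for s t
    unfolding A_def B_def C_def square_term[symmetric]
    unfolding set_lebesgue_integral_def
  proof (rule Bochner_Integration.integral_nonneg)
    fix x
    show "0 \<le> indicat_real (hyp_ball R) x *\<^sub>R (V (hyp_rho x) *
      (hyp_norm x ((s * u x * g (hyp_rho x)) *\<^sub>R hyp_grad hyp_rho x - t *\<^sub>R hyp_grad u x))\<^sup>2)"
    proof (cases "x \<in> K")
      case True
      then show ?thesis using V in_S(3) S_K(3) by (auto simp: indicator_def)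
    qed (simp add: u_off grad_off hyp_grad_def hyp_norm_def hyp_inner_def)
  qed
  have A0: "0 \<le> A" and B0: "0 \<le> B" using quad[of 0 1] quad[of 1 0] by auto
  have "C \<le> sqrt A * sqrt B"
  proof -
    have "C\<^sup>2 \<le> A * B"
    proof (cases "A = 0")
      case True
      have "C = 0"
      proof (rule ccontr)
        assume "C \<noteq> 0"
        \<comment> \<open>With \<open>A = 0\<close> the form is \<open>B - 2 * t * C\<close> at
          \<open>s = 1\<close>; the chosen \<open>t\<close> makes it equal to -1.\<close>
        then show False using quad[of 1 "(B + 1) / (2 * C)"] True by simp
      qed
      then show ?thesis using True by simp
    next
      case False
      \<comment> \<open>The choice \<open>s = A\<close>, \<open>t = C\<close> is proportional to the
        minimizer of the form and produces the discriminant.\<close>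
      have "0 \<le> A * (A * B - C\<^sup>2)"
        using quad[of A C] by (simp add: algebra_simps power2_eq_square)
      then show ?thesis using False A0 by (simp add: zero_le_mult_iff)
    qed
    then show ?thesis by (simp add: real_le_rsqrt real_sqrt_mult[symmetric])
  qed
  moreover have "(LINT x:hyp_ball R|hyp_volume. d\<^sub>2 x) \<le> 0"
  proof -
    have "d\<^sub>2 x \<le> 0" for x
    proof (cases "x \<in> K")
      case True
      then have x: "hyp_rho x \<in> radial_interval R" using S_K(3) in_S(3) by auto
      then have "0 < hyp_rho x" by (simp add: radial_interval_def)
      then have "0 \<le> (hyp_rho x * cosh (hyp_rho x) - sinh (hyp_rho x)) / (hyp_rho x * sinh (hyp_rho x))"
        using sinh_le_mult_cosh[of "hyp_rho x"] by simp
      then show ?thesis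
        using V[OF x] g[OF x] unfolding d\<^sub>2_def g_def
        by (intro mult_nonpos_nonneg mult_nonneg_nonpos) auto
    qed (simp add: integrand_off)
    then have "0 \<le> (LINT x:hyp_ball R|hyp_volume. - d\<^sub>2 x)"
      unfolding set_lebesgue_integral_def by (intro Bochner_Integration.integral_nonneg) (simp add: indicator_def)
    then show ?thesis by (simp add: set_lebesgue_integral_def)
  qed
  then have "0 \<le> - ((real CARD('n) - 1) * (LINT x:hyp_ball R|hyp_volume. d\<^sub>2 x))"
    by (simp add: mult_nonneg_nonpos)
  ultimately show ?thesis
    using cross_term unfolding A_def B_def C_def by simp
qed

end

theorem theorem1p2:
  fixes R :: ereal and V W \<phi> :: "real \<Rightarrow> real" and N :: nat
  assumes N: "N = CARD('n::finite)"
    and R: "0 < R"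
    and V_C1: "V C1_differentiable_on radial_interval R"
    and V_nonneg: "\<And>r. r \<in> radial_interval R \<Longrightarrow> V r \<ge> 0"
    and W_C1: "W C1_differentiable_on radial_interval R"
    and bessel: "bessel_pair R (\<lambda>r. r ^ (N - 1) * V r) (\<lambda>r. r ^ (N - 1) * W r) \<phi>"
  shows "(\<forall>u \<in> test_functions (hyp_ball R - {0 :: real ^ 'n}).
      let A = (LINT x:hyp_ball R|hyp_volume. V (hyp_rho x) * (hyp_norm x (hyp_grad u x))\<^sup>2);
          B = (LINT x:hyp_ball R|hyp_volume.
                 V (hyp_rho x) * ((deriv \<phi> (hyp_rho x))\<^sup>2 / (\<phi> (hyp_rho x))\<^sup>2) * \<bar>u x\<bar>\<^sup>2);
          lam = root 4 (B / A)
      in A > 0 \<longrightarrow> B > 0 \<longrightarrow>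
        sqrt A * sqrt B =
          1 / 2 * (LINT x:hyp_ball R|hyp_volume.
            (W (hyp_rho x) + V (hyp_rho x) * ((deriv \<phi> (hyp_rho x))\<^sup>2 / (\<phi> (hyp_rho x))\<^sup>2)) * \<bar>u x\<bar>\<^sup>2)
          - (real N - 1) / 2 * (LINT x:hyp_ball R|hyp_volume.
              V (hyp_rho x) * (deriv \<phi> (hyp_rho x) / \<phi> (hyp_rho x))
              * ((hyp_rho x * cosh (hyp_rho x) - sinh (hyp_rho x)) / (hyp_rho x * sinh (hyp_rho x)))
              * \<bar>u x\<bar>\<^sup>2)
          + 1 / 2 * (LINT x:hyp_ball R|hyp_volume.
              V (hyp_rho x)
              * (hyp_norm x ((1 / lam * u x * (deriv \<phi> (hyp_rho x) / \<phi> (hyp_rho x))) *\<^sub>R hyp_grad hyp_rho x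
                             - lam *\<^sub>R hyp_grad u x))\<^sup>2))
    \<and> ((\<forall>r\<in>radial_interval R. deriv \<phi> r / \<phi> r \<le> 0) \<longrightarrow>
      (\<forall>u \<in> test_functions (hyp_ball R - {0 :: real ^ 'n}).
        sqrt (LINT x:hyp_ball R|hyp_volume. V (hyp_rho x) * (hyp_norm x (hyp_grad u x))\<^sup>2)
        * sqrt (LINT x:hyp_ball R|hyp_volume.
                 V (hyp_rho x) * ((deriv \<phi> (hyp_rho x))\<^sup>2 / (\<phi> (hyp_rho x))\<^sup>2) * \<bar>u x\<bar>\<^sup>2)
        \<ge> 1 / 2 * (LINT x:hyp_ball R|hyp_volume.
            (W (hyp_rho x) + V (hyp_rho x) * ((deriv \<phi> (hyp_rho x))\<^sup>2 / (\<phi> (hyp_rho x))\<^sup>2)) * \<bar>u x\<bar>\<^sup>2)))"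
proof -
  have I: "hyp_bessel_pair R V W \<phi> u" if "u \<in> test_functions (hyp_ball R - {0 :: real ^ 'n})" for u
    using V_C1 W_C1 bessel that unfolding N by unfold_locales
  show ?thesis
  proof (intro conjI ballI impI, goal_cases)
    case (1 u)
    then interpret hyp_bessel_pair R V W \<phi> u by (rule I)
    show ?case
      unfolding Let_def integrand_a integrand_b integrand_d\<^sub>1 integrand_d\<^sub>2 N
      by (intro impI uncertainty_identity refl)
  next
    case (2 u)
    then interpret hyp_bessel_pair R V W \<phi> u by (intro I)
    show ?case
      unfolding integrand_a integrand_b integrand_d\<^sub>1
      using uncertainty_inequality V_nonneg 2 by blast
  qed
qed

end
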